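(* Let $G$ be a graph and $\Gamma$ an amenable subgroup of $\mathrm{Aut}(G)$. If there is a doubling measure $\mu$ on $G$ which is bounded, then there is a doubling measure $\mu_\Gamma$ on $G$ such that (i) $\mu_\Gamma$ is invariant under $\Gamma$, i.e. $\mu_\Gamma(\sigma(v))=\mu_\Gamma(v)$ for all $\sigma\in\Gamma$, $v\in V_G$; and (ii) $C_{\mu_\Gamma}\le C_\mu$.
   Context: A graph is a locally finite, undirected, connected, simple graph $G$ with vertex set $V_G$ and edge set $E_G$, with path distance $d_G$ and closed balls $B(v,r)=\{w: d_G(v,w)\le r\}$. $\mathrm{Aut}(G)$ is the group of permutations $\sigma$ of $V_G$ with $\{u,v\}\in E_G\iff\{\sigma(u),\sigma(v)\}\in E_G$. A subgroup $\Gamma\le\mathrm{Aut}(G)$ is called amenable if there are finite sets $F_n\subseteq\Gamma$, $n\in\mathbb N$, with $F_n\subseteq F_{n+1}$, $\bigcup_nF_n=\Gamma$, and $|F_n\sigma\,\Delta\,F_n|/|F_n|\to0$ as $n\to\infty$ for every $\sigma\in\Gamma$, where $F_n\sigma=\{\tau\sigma:\tau\in F_n\}$ and $\Delta$ is symmetric difference. A measure on $G$ is a function $\mu:V_G\to(0,\infty)$, $\mu(A)=\sum_{v\in A}\mu(v)$; it is bounded if $\sup_v\mu(v)<\infty$, and doubling if $C_\mu=\sup_{v,\,r\ge0}\mu(B(v,2r))/\mu(B(v,r))<\infty$. *)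

theory Defs
  imports
    Complex_Main
    "HOL-Library.Extended_Real"
    "HOL-Combinatorics.Permutations"
    "HOL-Algebra.Group"
begin

definition adj :: "'a set set \<Rightarrow> ('a \<times> 'a) set" where
  "adj E = {(u, v). {u, v} \<in> E}"

locale lf_graph =
  fixes V :: "'a set" and E :: "'a set set"
  assumes edges: "e \<in> E \<Longrightarrow> e \<subseteq> V \<and> card e = 2"
    and locally_finite: "v \<in> V \<Longrightarrow> finite {w. {v, w} \<in> E}"
    and connected: "u \<in> V \<Longrightarrow> v \<in> V \<Longrightarrow> (u, v) \<in> (adj E)\<^sup>*"

text \<open>The relational power \<open>adj E ^^ n\<close> relates the endpoints of walks with \<open>n\<close> edges; a
  shortest walk is a shortest path. The distance is only meaningful between connected vertices.\<close>

definition gdist :: "'a set set \<Rightarrow> 'a \<Rightarrow> 'a \<Rightarrow> nat" where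
  "gdist E u v = (LEAST n. (u, v) \<in> adj E ^^ n)"

definition gball :: "'a set \<Rightarrow> 'a set set \<Rightarrow> 'a \<Rightarrow> real \<Rightarrow> 'a set" where
  "gball V E v r = {w \<in> V. real (gdist E v w) \<le> r}"

text \<open>As for \<open>sym_group\<close> in the library, permutations of the set \<open>V\<close> are functions that are the
  identity outside \<open>V\<close>, so that equality of automorphisms is equality of functions.\<close>

definition aut_group :: "'a set \<Rightarrow> 'a set set \<Rightarrow> ('a \<Rightarrow> 'a) monoid" where
  "aut_group V E =
    \<lparr> carrier = {\<sigma>. \<sigma> permutes V \<and> (\<forall>u\<in>V. \<forall>v\<in>V. {u, v} \<in> E \<longleftrightarrow> {\<sigma> u, \<sigma> v} \<in> E)},
      mult = (\<circ>), one = id \<rparr>"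

text \<open>The sets \<open>F n\<close> are nonempty for large \<open>n\<close> as soon as \<open>\<Gamma>\<close> is, so the value of the quotient
  at \<open>F n = {}\<close> does not affect the limit.\<close>

definition amenable :: "('a \<Rightarrow> 'a) set \<Rightarrow> bool" where
  "amenable \<Gamma> \<longleftrightarrow>
    (\<exists>F :: nat \<Rightarrow> ('a \<Rightarrow> 'a) set.
      (\<forall>n. finite (F n)) \<and> (\<forall>n. F n \<subseteq> \<Gamma>) \<and> (\<forall>n. F n \<subseteq> F (Suc n)) \<and> (\<Union>n. F n) = \<Gamma> \<and>
      (\<forall>\<sigma>\<in>\<Gamma>. (\<lambda>n. real (card (sym_diff ((\<lambda>\<tau>. \<tau> \<circ> \<sigma>) ` F n) (F n))) / real (card (F n)))
        \<longlonglongrightarrow> 0))"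

definition graph_measure :: "'a set \<Rightarrow> ('a \<Rightarrow> real) \<Rightarrow> bool" where
  "graph_measure V \<mu> \<longleftrightarrow> (\<forall>v\<in>V. 0 < \<mu> v)"

definition bounded_measure :: "'a set \<Rightarrow> ('a \<Rightarrow> real) \<Rightarrow> bool" where
  "bounded_measure V \<mu> \<longleftrightarrow> bdd_above (\<mu> ` V)"

text \<open>The radius is real, so \<open>r = 1/2\<close> compares a vertex with its closed neighbourhood. The sums
  are over finite sets by \<open>finite_gball\<close> below.\<close>

definition doubling_const :: "'a set \<Rightarrow> 'a set set \<Rightarrow> ('a \<Rightarrow> real) \<Rightarrow> ereal" where
  "doubling_const V E \<mu> =
    (SUP v\<in>V. SUP r\<in>{0..}. ereal (sum \<mu> (gball V E v (2 * r)) / sum \<mu> (gball V E v r)))"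

definition doubling_measure :: "'a set \<Rightarrow> 'a set set \<Rightarrow> ('a \<Rightarrow> real) \<Rightarrow> bool" where
  "doubling_measure V E \<mu> \<longleftrightarrow> graph_measure V \<mu> \<and> doubling_const V E \<mu> < \<infinity>"

lemma group_aut_group: "group (aut_group V E)"
proof (rule groupI)
  fix \<sigma> assume s: "\<sigma> \<in> carrier (aut_group V E)"
  then have p: "\<sigma> permutes V"
    and e: "\<And>u v. u \<in> V \<Longrightarrow> v \<in> V \<Longrightarrow> {u, v} \<in> E \<longleftrightarrow> {\<sigma> u, \<sigma> v} \<in> E"
    by (auto simp: aut_group_def)
  let ?i = "inv_into UNIV \<sigma>"
  have "{u, v} \<in> E \<longleftrightarrow> {?i u, ?i v} \<in> E" if "u \<in> V" "v \<in> V" for u v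
    using e[of "?i u" "?i v"] that p
    by (simp add: permutes_in_image[OF permutes_inv[OF p]] permutes_inverses[OF p])
  moreover have "?i permutes V" "?i \<circ> \<sigma> = id"
    using p by (simp_all add: permutes_inv permutes_inv_o)
  ultimately show "\<exists>\<tau>\<in>carrier (aut_group V E). \<tau> \<otimes>\<^bsub>aut_group V E\<^esub> \<sigma> = \<one>\<^bsub>aut_group V E\<^esub>"
    by (intro bexI[of _ ?i]) (simp_all add: aut_group_def)
next
  fix \<sigma> \<tau> assume "\<sigma> \<in> carrier (aut_group V E)" "\<tau> \<in> carrier (aut_group V E)"
  then show "\<sigma> \<otimes>\<^bsub>aut_group V E\<^esub> \<tau> \<in> carrier (aut_group V E)"
    unfolding aut_group_def by (simp add: permutes_compose) (metis permutes_in_image)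
qed (simp_all add: aut_group_def permutes_id comp_assoc)

lemma (in lf_graph) finite_gball: "v \<in> V \<Longrightarrow> finite (gball V E v r)"
proof -
  assume v: "v \<in> V"
  have *: "finite {w. (v, w) \<in> adj E ^^ n} \<and> {w. (v, w) \<in> adj E ^^ n} \<subseteq> V" for n
  proof (induction n)
    case 0
    then show ?case using v by simp
  next
    case (Suc n)
    have "{w. (v, w) \<in> adj E ^^ Suc n} = (\<Union>u\<in>{u. (v, u) \<in> adj E ^^ n}. {w. {u, w} \<in> E})"
      by (auto simp: adj_def)
    moreover have "finite {w. {u, w} \<in> E} \<and> {w. {u, w} \<in> E} \<subseteq> V" if "u \<in> {u. (v, u) \<in> adj E ^^ n}" for u
      using that Suc locally_finite edges by blast
    ultimately show ?case using Suc by (metis (no_types, lifting) UN_least finite_UN_I)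
  qed
  have "gball V E v r \<subseteq> (\<Union>n\<in>{..nat \<lfloor>r\<rfloor>}. {w. (v, w) \<in> adj E ^^ n})"
  proof
    fix w assume w: "w \<in> gball V E v r"
    then have "\<exists>n. (v, w) \<in> adj E ^^ n"
      using connected[OF v] by (auto simp: gball_def dest: rtrancl_imp_relpow)
    then have "(v, w) \<in> adj E ^^ gdist E v w"
      unfolding gdist_def by (rule LeastI_ex)
    moreover have "gdist E v w \<le> nat \<lfloor>r\<rfloor>"
      using w by (simp add: gball_def le_nat_floor)
    ultimately show "w \<in> (\<Union>n\<in>{..nat \<lfloor>r\<rfloor>}. {w. (v, w) \<in> adj E ^^ n})" by blast
  qed
  then show ?thesis using * by (meson finite_UN_I finite_atMost finite_subset)
qed

end

theory Submission
  imports Defs "HOL-Complex_Analysis.Great_Picard" "HOL-Real_Asymp.Real_Asymp"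
begin

text \<open>
  Fix a vertex \<open>b\<close> and integrate \<open>\<mu> (h v)\<close> over those \<open>h\<close> in the closure of \<open>\<Gamma>\<close> that move \<open>b\<close> by at
  most \<open>R\<close>, with respect to left Haar measure; only the restriction of \<open>h\<close> to a finite set matters,
  so the integral is a finite sum over such restrictions divided by an index of stabilisers.
  The result \<open>avg R v\<close> is doubling with the same constant, and translating \<open>v\<close> by \<open>\<sigma>\<close> changes it by the
  factor \<open>chi \<sigma>\<close> of the modular function, up to enlarging \<open>R\<close> by a constant. Doubling makes
  \<open>avg R b\<close> grow polynomially in \<open>R\<close>, so along suitable radii the enlargement is negligible
  relative to \<open>avg R b\<close>, and a limit of \<open>avg R v / avg R b\<close> is a doubling measure that \<open>\<sigma>\<close> scales
  by \<open>chi \<sigma>\<close>. If \<open>chi \<sigma> > 1\<close>, this measure would grow exponentially along the orbit of \<open>b\<close> under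
  \<open>\<sigma>\<close>, contradicting doubling; hence \<open>chi = 1\<close>.
\<close>

section \<open>Exponential against polynomial growth\<close>

text \<open>Taking logarithms and dividing by \<open>2 ^ i\<close> leaves a bound on
  \<open>ln a\<close> that tends to 0. Here \<open>i\<close> counts doublings of a radius: at radius
  of order \<open>2 ^ i\<close>, doubling allows only a factor \<open>C ^ i\<close>, which rules out
  growth of the form \<open>a ^ (2 ^ i)\<close> with \<open>a > 1\<close>.\<close>

lemma le_one_if_double_exp_le:
  fixes a B C :: real
  assumes "0 < a" "0 < B" "0 < C" and le: "\<And>i::nat. a ^ (2 ^ i) \<le> B * C ^ i"
  shows "a \<le> 1"
proof -
  have "ln a \<le> (ln B + real i * ln C) / 2 ^ i" for i
  proof -
    have "ln (a ^ (2 ^ i)) \<le> ln (B * C ^ i)"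
      using le[of i] assms(1-3) by (subst ln_le_cancel_iff) auto
    then have "2 ^ i * ln a \<le> ln B + real i * ln C"
      using assms(1-3) by (simp add: ln_realpow ln_mult)
    then show ?thesis by (simp add: field_simps)
  qed
  moreover have "(\<lambda>i::nat. (ln B + real i * ln C) / 2 ^ i) \<longlonglongrightarrow> 0"
    by real_asymp
  ultimately have "ln a \<le> 0"
    by (meson LIMSEQ_le_const)
  then show ?thesis using assms(1) by simp
qed

section \<open>Distances, balls and automorphisms\<close>

context lf_graph
begin

lemma gdist_walk: "u \<in> V \<Longrightarrow> v \<in> V \<Longrightarrow> (u, v) \<in> adj E ^^ gdist E u v"
  unfolding gdist_def using connected rtrancl_imp_relpow by (metis LeastI_ex)

lemma gdist_le: "(u, v) \<in> adj E ^^ n \<Longrightarrow> gdist E u v \<le> n"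
  unfolding gdist_def by (rule Least_le)

lemma gdist_self [simp]: "gdist E u u = 0"
  using gdist_le[of u u 0] by simp

lemma gdist_eq_0: "u \<in> V \<Longrightarrow> v \<in> V \<Longrightarrow> gdist E u v = 0 \<Longrightarrow> u = v"
  using gdist_walk[of u v] by simp

lemma gdist_triangle:
  assumes "u \<in> V" "v \<in> V" "w \<in> V"
  shows "gdist E u w \<le> gdist E u v + gdist E v w"
  using relpow_trans[OF gdist_walk[OF assms(1,2)] gdist_walk[OF assms(2,3)]] gdist_le by blast

lemma gdist_commute_le: "u \<in> V \<Longrightarrow> v \<in> V \<Longrightarrow> gdist E u v \<le> gdist E v u"
proof -
  assume *: "u \<in> V" "v \<in> V"
  have "(y, x) \<in> adj E ^^ n" if "(x, y) \<in> adj E ^^ n" for x y n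
    using that
  proof (induction n arbitrary: y)
    case (Suc n)
    then obtain z where "(x, z) \<in> adj E ^^ n" "(z, y) \<in> adj E" by auto
    moreover have "(y, z) \<in> adj E"
      using calculation(2) by (simp add: adj_def insert_commute)
    ultimately show ?case using Suc.IH relpow_Suc_I2 by metis
  qed simp
  from this[OF gdist_walk[OF *(2,1)]] show ?thesis by (rule gdist_le)
qed

lemma gdist_commute: "u \<in> V \<Longrightarrow> v \<in> V \<Longrightarrow> gdist E u v = gdist E v u"
  by (simp add: gdist_commute_le antisym)

lemma gball_subset: "gball V E v r \<subseteq> V"
  by (auto simp: gball_def)

lemma gball_mono: "r \<le> s \<Longrightarrow> gball V E v r \<subseteq> gball V E v s"
  by (auto simp: gball_def)

lemma gball_centre: "v \<in> V \<Longrightarrow> 0 \<le> r \<Longrightarrow> v \<in> gball V E v r"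
  by (simp add: gball_def)

lemma gball_less_one: "v \<in> V \<Longrightarrow> 0 \<le> r \<Longrightarrow> r < 1 \<Longrightarrow> gball V E v r = {v}"
  by (auto simp: gball_def dest: gdist_eq_0)

lemma sum_gball_pos:
  assumes "graph_measure V \<mu>" "v \<in> V" "0 \<le> r"
  shows "0 < sum \<mu> (gball V E v r)"
proof (rule sum_pos)
  show "0 < \<mu> w" if "w \<in> gball V E v r" for w
    using that gball_subset assms(1) unfolding graph_measure_def by blast
  show "gball V E v r \<noteq> {}" using gball_centre assms(2,3) by blast
qed (use assms finite_gball in auto)

text \<open>The finite balls around one vertex exhaust \<open>V\<close>. Countability permits the
  diagonal extraction in \<open>equivariant_limit\<close>.\<close>

lemma countable_V: "countable V"
proof (cases "V = {}")
  case False
  then obtain u where "u \<in> V" by blast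
  moreover have "V = (\<Union>n::nat. gball V E u (real n))"
    by (auto simp: gball_def)
  ultimately show ?thesis
    using finite_gball by (metis countable_UN countable_finite countableI_type)
qed simp

text \<open>Automorphisms carry walks to walks of the same length, so they do not increase
  distances; the inverse gives the other inequality.\<close>

lemma aut_gdist:
  assumes h: "h \<in> carrier (aut_group V E)" and uv: "u \<in> V" "v \<in> V"
  shows "gdist E (h u) (h v) = gdist E u v"
proof -
  have le: "gdist E (k x) (k y) \<le> gdist E x y"
    if k: "k \<in> carrier (aut_group V E)" and "x \<in> V" "y \<in> V" for k x y
  proof -
    have "(k x, k z) \<in> adj E ^^ n" if "(x, z) \<in> adj E ^^ n" for z n
      using that
    proof (induction n arbitrary: z)
      case (Suc n)
      then obtain w where w: "(x, w) \<in> adj E ^^ n" "{w, z} \<in> E" by (auto simp: adj_def)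
      moreover have "w \<in> V" "z \<in> V" using edges[OF w(2)] by auto
      ultimately have "{k w, k z} \<in> E"
        using k by (simp add: aut_group_def)
      then show ?case using Suc.IH[OF w(1)] by (auto simp: adj_def)
    qed simp
    then show ?thesis using gdist_walk[OF that(2,3)] by (blast intro: gdist_le)
  qed
  interpret group "aut_group V E" by (rule group_aut_group)
  define g where "g = inv\<^bsub>aut_group V E\<^esub> h"
  have g: "g \<in> carrier (aut_group V E)"
    using h by (simp add: g_def)
  have "g \<circ> h = id"
    using l_inv[OF h] by (simp add: g_def[symmetric]) (simp add: aut_group_def)
  then have gh: "g (h x) = x" for x
    by (metis comp_apply id_apply)
  have "h u \<in> V" "h v \<in> V"
    using h uv by (auto simp: aut_group_def permutes_in_image)
  then show ?thesis
    using le[OF h uv] le[OF g, of "h u" "h v"] by (simp add: gh)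
qed

lemma aut_gball:
  assumes h: "h \<in> carrier (aut_group V E)" and "v \<in> V"
  shows "h ` gball V E v r = gball V E (h v) r"
proof -
  have p: "h permutes V" using h by (simp add: aut_group_def)
  have "w \<in> h ` gball V E v r" if w: "w \<in> gball V E (h v) r" for w
  proof -
    obtain x where "x \<in> V" "w = h x"
      using w p gball_subset by (metis imageE permutes_image subsetD)
    then show ?thesis using w aut_gdist[OF h assms(2)] by (auto simp: gball_def)
  qed
  moreover have "h ` gball V E v r \<subseteq> gball V E (h v) r"
    using aut_gdist[OF h assms(2)] p by (auto simp: gball_def permutes_in_image)
  ultimately show ?thesis by blast
qed

section \<open>The doubling inequality\<close>

lemma doubling_iterate:
  fixes \<mu> :: "'a \<Rightarrow> real" and C :: real
  assumes "\<And>r. 0 \<le> r \<Longrightarrow> sum \<mu> (gball V E v (2 * r)) \<le> C * sum \<mu> (gball V E v r)"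
    and "0 \<le> C" "0 \<le> r"
  shows "sum \<mu> (gball V E v (2 ^ i * r)) \<le> C ^ i * sum \<mu> (gball V E v r)"
proof (induction i)
  case (Suc i)
  have "sum \<mu> (gball V E v (2 * (2 ^ i * r))) \<le> C * sum \<mu> (gball V E v (2 ^ i * r))"
    using assms by simp
  also have "\<dots> \<le> C * (C ^ i * sum \<mu> (gball V E v r))"
    by (rule mult_left_mono[OF Suc assms(2)])
  finally show ?case by (simp add: mult_ac)
qed simp

lemma doubling_const_leI:
  assumes "graph_measure V \<mu>"
    and "\<And>v r. v \<in> V \<Longrightarrow> 0 \<le> r \<Longrightarrow>
      sum \<mu> (gball V E v (2 * r)) \<le> C * sum \<mu> (gball V E v r)"
  shows "doubling_const V E \<mu> \<le> ereal C"
  unfolding doubling_const_def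
proof (intro SUP_least)
  fix v r assume v: "v \<in> V" and r: "r \<in> {0::real..}"
  have "0 < sum \<mu> (gball V E v r)"
    using sum_gball_pos[OF assms(1) v] r by simp
  then show "ereal (sum \<mu> (gball V E v (2 * r)) / sum \<mu> (gball V E v r)) \<le> ereal C"
    using assms(2)[OF v] r by (simp add: divide_le_eq)
qed

lemma doubling_measureE:
  assumes "doubling_measure V E \<mu>" "V \<noteq> {}"
  obtains C where "1 \<le> C" "doubling_const V E \<mu> = ereal C"
    "\<And>v r. v \<in> V \<Longrightarrow> 0 \<le> r \<Longrightarrow>
      sum \<mu> (gball V E v (2 * r)) \<le> C * sum \<mu> (gball V E v r)"
proof -
  have pos: "0 < sum \<mu> (gball V E v r)" if "v \<in> V" "0 \<le> r" for v r
    using that assms(1) sum_gball_pos by (simp add: doubling_measure_def)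
  have up: "ereal (sum \<mu> (gball V E v (2 * r)) / sum \<mu> (gball V E v r)) \<le> doubling_const V E \<mu>"
    if "v \<in> V" "0 \<le> r" for v r
    unfolding doubling_const_def using that
    by (intro SUP_upper2[OF that(1)] SUP_upper2[of r]) auto
  obtain u where u: "u \<in> V" using assms(2) by blast
  \<comment> \<open>At radius 0 the two balls coincide, so 1 is among the quotients.\<close>
  have one: "1 \<le> doubling_const V E \<mu>"
    using up[OF u, of 0] pos[OF u, of 0] by (simp add: one_ereal_def)
  moreover have "doubling_const V E \<mu> < \<infinity>"
    using assms(1) by (simp add: doubling_measure_def)
  ultimately obtain C where C: "doubling_const V E \<mu> = ereal C"
    by (cases "doubling_const V E \<mu>") auto
  show ?thesis
  proof (rule that[OF _ C])
    show "1 \<le> C" using one C by simp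
    show "sum \<mu> (gball V E v (2 * r)) \<le> C * sum \<mu> (gball V E v r)" if "v \<in> V" "0 \<le> r" for v r
      using up[OF that] pos[OF that] C by (simp add: divide_le_eq)
  qed
qed

end

section \<open>A group of automorphisms and a base vertex\<close>

text \<open>The constant is a real number entering through a linear inequality between ball sums;
  such an inequality survives averaging and pointwise limits.\<close>

locale doubling_action = lf_graph V E
  for V :: "'a set" and E :: "'a set set" +
  fixes \<Gamma> :: "('a \<Rightarrow> 'a) set" and \<mu> :: "'a \<Rightarrow> real" and C :: real and b :: 'a
  assumes subgroup_\<Gamma>: "subgroup \<Gamma> (aut_group V E)"
    and pos: "v \<in> V \<Longrightarrow> 0 < \<mu> v"
    and C_ge_1: "1 \<le> C"
    and doubling: "v \<in> V \<Longrightarrow> 0 \<le> r \<Longrightarrow>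
      sum \<mu> (gball V E v (2 * r)) \<le> C * sum \<mu> (gball V E v r)"
    and b_in_V: "b \<in> V"
begin

lemma aut: "h \<in> \<Gamma> \<Longrightarrow> h \<in> carrier (aut_group V E)"
  using subgroup_\<Gamma> subgroup.subset by blast

lemma permutes: "h \<in> \<Gamma> \<Longrightarrow> h permutes V"
  using aut by (simp add: aut_group_def)

lemma in_V [simp]: "h \<in> \<Gamma> \<Longrightarrow> h v \<in> V \<longleftrightarrow> v \<in> V"
  by (rule permutes_in_image[OF permutes])

lemma id_in: "id \<in> \<Gamma>"
  using subgroup.one_closed[OF subgroup_\<Gamma>] by (simp add: aut_group_def)

lemma comp_in: "g \<in> \<Gamma> \<Longrightarrow> h \<in> \<Gamma> \<Longrightarrow> g \<circ> h \<in> \<Gamma>"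
  using subgroup.m_closed[OF subgroup_\<Gamma>] by (simp add: aut_group_def)

lemma inverse_in:
  assumes h: "h \<in> \<Gamma>"
  shows "inv_into UNIV h \<in> \<Gamma>"
proof -
  interpret group "aut_group V E" by (rule group_aut_group)
  define g where "g = inv\<^bsub>aut_group V E\<^esub> h"
  have "g \<in> \<Gamma>" using subgroup.m_inv_closed[OF subgroup_\<Gamma> h] by (simp add: g_def)
  moreover have "h \<circ> g = id" "g \<circ> h = id"
    using r_inv[OF aut[OF h]] l_inv[OF aut[OF h]]
    by (simp_all add: g_def[symmetric]) (simp_all add: aut_group_def)
  ultimately show ?thesis using inv_unique_comp by metis
qed

lemma inverse_simps [simp]:
  assumes "h \<in> \<Gamma>"
  shows "h (inv_into UNIV h v) = v" "inv_into UNIV h (h v) = v"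
  using permutes_inverses[OF permutes[OF assms]] by auto

lemma inj: "h \<in> \<Gamma> \<Longrightarrow> h x = h y \<longleftrightarrow> x = y"
  by (rule inj_eq[OF permutes_inj[OF permutes]])

section \<open>Stabiliser indices and sums over restrictions\<close>

text \<open>For \<open>h\<close> in \<open>\<Gamma>\<close> this is the left coset of
  \<open>h\<close> modulo the pointwise stabiliser of \<open>A\<close>.\<close>

definition fibre :: "'a set \<Rightarrow> ('a \<Rightarrow> 'a) \<Rightarrow> ('a \<Rightarrow> 'a) set" where
  "fibre A h = {k \<in> \<Gamma>. \<forall>a\<in>A. k a = h a}"

text \<open>Since \<open>restrict\<close> fixes the values off \<open>T\<close>, distinct members
  differ on \<open>T\<close>: they label the cosets of the pointwise stabiliser of \<open>T\<close>
  that meet \<open>X\<close>.\<close>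

abbreviation res :: "'a set \<Rightarrow> ('a \<Rightarrow> 'a) set \<Rightarrow> ('a \<Rightarrow> 'a) set" where
  "res T X \<equiv> (\<lambda>k. restrict k T) ` X"

text \<open>For \<open>A \<subseteq> T\<close> this is the index of the pointwise stabiliser of \<open>T\<close> in that of \<open>A\<close>.\<close>

definition idx :: "'a set \<Rightarrow> 'a set \<Rightarrow> nat" where
  "idx A T = card (res T (fibre A id))"

text \<open>Left multiplication by \<open>h\<close> maps the stabiliser of \<open>A\<close> onto its
  coset and is injective on restrictions. This is the left invariance of Haar measure in finite
  form.\<close>

lemma card_res_fibre:
  assumes h: "h \<in> \<Gamma>"
  shows "card (res T (fibre A h)) = idx A T"
proof -
  let ?\<phi> = "\<lambda>p. restrict (h \<circ> p) T"
  have "?\<phi> ` res T (fibre A id) = res T ((\<lambda>k. h \<circ> k) ` fibre A id)"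
    by (auto simp: image_image intro!: image_cong)
  also have "(\<lambda>k. h \<circ> k) ` fibre A id = fibre A h"
  proof (intro equalityI subsetI)
    fix k assume k: "k \<in> fibre A h"
    then have "k = h \<circ> (inv_into UNIV h \<circ> k)" "inv_into UNIV h \<circ> k \<in> fibre A id"
      using h by (auto simp: fibre_def fun_eq_iff comp_in inverse_in)
    then show "k \<in> (\<lambda>k. h \<circ> k) ` fibre A id" by blast
  qed (use h comp_in in \<open>auto simp: fibre_def\<close>)
  finally have im: "?\<phi> ` res T (fibre A id) = res T (fibre A h)" .
  have "inj_on ?\<phi> (res T (fibre A id))"
  proof (rule inj_onI)
    fix p q assume p: "p \<in> res T (fibre A id)" and q: "q \<in> res T (fibre A id)"
      and eq: "?\<phi> p = ?\<phi> q"
    have "p x = q x" for x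
    proof (cases "x \<in> T")
      case True
      then have "h (p x) = h (q x)" using fun_cong[OF eq, of x] by simp
      then show ?thesis using inj[OF h] by simp
    qed (use p q in auto)
    then show "p = q" by blast
  qed
  from card_image[OF this] show ?thesis by (simp only: im idx_def)
qed

text \<open>As \<open>X\<close> is a union of fibres over \<open>A\<close>, each restriction to
  \<open>A\<close> has exactly \<open>idx A T\<close> extensions to \<open>T\<close>.\<close>

lemma sum_res:
  fixes f :: "('a \<Rightarrow> 'a) \<Rightarrow> real"
  assumes "A \<subseteq> T" "X \<subseteq> \<Gamma>" and closed: "\<And>h. h \<in> X \<Longrightarrow> fibre A h \<subseteq> X"
    and fin: "finite (res T X)"
  shows "(\<Sum>q\<in>res T X. f (restrict q A)) = real (idx A T) * (\<Sum>p\<in>res A X. f p)"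
proof -
  have im: "(\<lambda>q. restrict q A) ` res T X = res A X"
    using assms(1) by (simp add: image_image restrict_restrict Int_absorb1)
  have card: "card {q \<in> res T X. restrict q A = p} = idx A T" if "p \<in> res A X" for p
  proof -
    obtain h where h: "h \<in> X" "p = restrict h A" using \<open>p \<in> res A X\<close> by blast
    have "{q \<in> res T X. restrict q A = p} = res T (fibre A h)"
    proof (intro equalityI subsetI)
      fix q assume "q \<in> {q \<in> res T X. restrict q A = p}"
      then obtain k where k: "k \<in> X" "q = restrict k T" "restrict q A = restrict h A"
        using h(2) by blast
      have "k a = h a" if "a \<in> A" for a
        using fun_cong[OF k(3), of a] that assms(1) k(2) by auto
      then have "k \<in> fibre A h" using k assms(2) by (auto simp: fibre_def)
      then show "q \<in> res T (fibre A h)" using k by blast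
    next
      fix q assume "q \<in> res T (fibre A h)"
      then obtain k where k: "k \<in> fibre A h" "q = restrict k T" by blast
      then have "restrict q A = restrict h A"
        using assms(1) by (auto simp: fibre_def fun_eq_iff)
      then show "q \<in> {q \<in> res T X. restrict q A = p}"
        using k closed[OF h(1)] h(2) by blast
    qed
    then show ?thesis using card_res_fibre h(1) assms(2) by auto
  qed
  have "(\<Sum>q\<in>res T X. f (restrict q A)) =
      (\<Sum>p\<in>res A X. \<Sum>q\<in>{q \<in> res T X. restrict q A = p}. f (restrict q A))"
    using sum.image_gen[OF fin, of "\<lambda>q. f (restrict q A)" "\<lambda>q. restrict q A"] by (simp only: im)
  also have "\<dots> = (\<Sum>p\<in>res A X. real (idx A T) * f p)"
    by (rule sum.cong[OF refl]) (simp add: card)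
  finally show ?thesis by (simp add: sum_distrib_left)
qed

lemma sum_res_translate:
  "(\<Sum>p\<in>res (\<sigma> ` T) X. f (restrict (p \<circ> \<sigma>) T)) = (\<Sum>q\<in>res T ((\<lambda>h. h \<circ> \<sigma>) ` X). f q)"
proof -
  let ?\<phi> = "\<lambda>p. restrict (p \<circ> \<sigma>) T"
  have "?\<phi> ` res (\<sigma> ` T) X = res T ((\<lambda>h. h \<circ> \<sigma>) ` X)"
    by (auto simp: image_image intro!: image_cong)
  moreover have "inj_on ?\<phi> (res (\<sigma> ` T) X)"
  proof (rule inj_onI)
    fix p q assume p: "p \<in> res (\<sigma> ` T) X" and q: "q \<in> res (\<sigma> ` T) X" and eq: "?\<phi> p = ?\<phi> q"
    have "p x = q x" for x
    proof (cases "x \<in> \<sigma> ` T")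
      case True
      then obtain t where "t \<in> T" "x = \<sigma> t" by blast
      then show ?thesis using fun_cong[OF eq, of t] by simp
    qed (use p q in auto)
    then show "p = q" by blast
  qed
  ultimately show ?thesis by (metis (mono_tags, lifting) sum.reindex_cong)
qed

lemma idx_translate:
  assumes \<sigma>: "\<sigma> \<in> \<Gamma>"
  shows "idx (\<sigma> ` A) (\<sigma> ` T) = idx A T"
proof -
  have "(\<lambda>h. h \<circ> \<sigma>) ` fibre (\<sigma> ` A) id = fibre A \<sigma>"
  proof (intro equalityI subsetI)
    fix k assume k: "k \<in> fibre A \<sigma>"
    then have "k = k \<circ> inv_into UNIV \<sigma> \<circ> \<sigma>" "k \<circ> inv_into UNIV \<sigma> \<in> fibre (\<sigma> ` A) id"
      using \<sigma> by (auto simp: fibre_def fun_eq_iff comp_in inverse_in)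
    then show "k \<in> (\<lambda>h. h \<circ> \<sigma>) ` fibre (\<sigma> ` A) id" by blast
  qed (use \<sigma> comp_in in \<open>auto simp: fibre_def\<close>)
  then show ?thesis
    using sum_res_translate[of "\<lambda>_. 1::nat" \<sigma> T "fibre (\<sigma> ` A) id"] card_res_fibre[OF \<sigma>]
    by (simp add: idx_def)
qed

section \<open>Averages over elements of bounded displacement\<close>

text \<open>The trace on \<open>\<Gamma>\<close> of a compact open subset of its closure.\<close>

definition near :: "nat \<Rightarrow> ('a \<Rightarrow> 'a) set" where
  "near R = {h \<in> \<Gamma>. gdist E b (h b) \<le> R}"

lemma near_subset: "near R \<subseteq> \<Gamma>"
  by (auto simp: near_def)

lemma near_mono: "R \<le> S \<Longrightarrow> near R \<subseteq> near S"
  by (auto simp: near_def)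

lemma fibre_near: "b \<in> A \<Longrightarrow> h \<in> near R \<Longrightarrow> fibre A h \<subseteq> near R"
  by (auto simp: near_def fibre_def)

text \<open>An isometry moving \<open>b\<close> by at most \<open>R\<close> sends \<open>t\<close>
  into the finite ball about \<open>b\<close> of radius \<open>R + gdist E b t\<close>.\<close>

lemma finite_res_near:
  assumes "finite T" "T \<subseteq> V"
  shows "finite (res T (near R))"
proof (rule finite_subset)
  let ?B = "\<lambda>t. gball V E b (real (R + gdist E b t))"
  show "res T (near R) \<subseteq> (\<Pi>\<^sub>E t\<in>T. ?B t)"
  proof (rule image_subsetI)
    fix h assume h: "h \<in> near R"
    then have \<Gamma>: "h \<in> \<Gamma>" by (simp add: near_def)
    have "h t \<in> ?B t" if "t \<in> T" for t
    proof -
      have t: "t \<in> V" using that assms(2) by blast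
      have "gdist E b (h t) \<le> gdist E b (h b) + gdist E (h b) (h t)"
        using gdist_triangle b_in_V t \<Gamma> by simp
      also have "\<dots> \<le> R + gdist E b t"
        using h aut_gdist[OF aut[OF \<Gamma>] b_in_V t] by (simp add: near_def)
      finally show ?thesis using t \<Gamma> by (simp add: gball_def del: of_nat_add)
    qed
    then show "restrict h T \<in> (\<Pi>\<^sub>E t\<in>T. ?B t)" by auto
  qed
  show "finite (\<Pi>\<^sub>E t\<in>T. ?B t)"
    using assms finite_gball b_in_V by (intro finite_PiE) auto
qed

lemma finite_res_fibre:
  assumes "finite T" "T \<subseteq> V" "b \<in> A"
  shows "finite (res T (fibre A id))"
proof -
  have "fibre A id \<subseteq> near 0" using assms(3) by (auto simp: fibre_def near_def)
  then show ?thesis using finite_res_near[OF assms(1,2)] by (meson finite_subset image_mono)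
qed

lemma idx_pos:
  assumes "finite T" "T \<subseteq> V" "b \<in> A"
  shows "0 < idx A T"
proof -
  have "id \<in> fibre A id" by (simp add: fibre_def id_in)
  then show ?thesis
    unfolding idx_def using finite_res_fibre[OF assms] by (auto simp: card_gt_0_iff)
qed

text \<open>The tower law for indices, obtained from \<open>sum_res\<close> with the constant
  function 1.\<close>

lemma idx_mult:
  assumes "b \<in> A" "A \<subseteq> B" "B \<subseteq> T" "finite T" "T \<subseteq> V"
  shows "idx A T = idx A B * idx B T"
proof -
  have "real (idx A T) = (\<Sum>q\<in>res T (fibre A id). 1)" by (simp add: idx_def)
  also have "\<dots> = real (idx B T) * (\<Sum>p\<in>res B (fibre A id). 1)"
    using assms finite_res_fibre[OF assms(4,5,1)]
    by (intro sum_res) (auto simp: fibre_def)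
  also have "\<dots> = real (idx A B * idx B T)" by (simp add: idx_def)
  finally show ?thesis by (simp only: of_nat_eq_iff)
qed

text \<open>The integral of \<open>\<mu> (h v)\<close> over \<open>near R\<close> with respect to the left Haar measure of the closure
  of \<open>\<Gamma>\<close>, normalised on the stabiliser of \<open>b\<close>.\<close>

definition avg :: "nat \<Rightarrow> 'a \<Rightarrow> real" where
  "avg R v = (\<Sum>p\<in>res {b, v} (near R). \<mu> (p v)) / real (idx {b} {b, v})"

text \<open>Passing from the window \<open>{b, v}\<close> to \<open>T\<close> multiplies numerator
  and denominator by \<open>idx {b, v} T\<close>. Averages at several vertices can thus be computed
  over one common window.\<close>

lemma avg_eq:
  assumes "finite T" "T \<subseteq> V" "b \<in> T" "v \<in> T"
  shows "avg R v = (\<Sum>p\<in>res T (near R). \<mu> (p v)) / real (idx {b} T)"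
proof -
  have "(\<Sum>p\<in>res T (near R). \<mu> (restrict p {b, v} v)) =
      real (idx {b, v} T) * (\<Sum>p\<in>res {b, v} (near R). \<mu> (p v))"
    using assms near_subset fibre_near finite_res_near by (intro sum_res) auto
  moreover have "idx {b} T = idx {b} {b, v} * idx {b, v} T"
    using assms by (intro idx_mult) auto
  moreover have "0 < idx {b, v} T" using assms by (intro idx_pos) auto
  ultimately show ?thesis by (simp add: avg_def)
qed

lemma near_translate:
  assumes h: "h \<in> near R" and \<sigma>: "\<sigma> \<in> \<Gamma>"
  shows "h \<circ> \<sigma> \<in> near (R + gdist E b (\<sigma> b))"
proof -
  have \<Gamma>: "h \<in> \<Gamma>" using h by (simp add: near_def)
  have "gdist E b (h (\<sigma> b)) \<le> gdist E b (h b) + gdist E (h b) (h (\<sigma> b))"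
    using gdist_triangle b_in_V \<Gamma> \<sigma> by simp
  also have "\<dots> \<le> R + gdist E b (\<sigma> b)"
    using h aut_gdist[OF aut[OF \<Gamma>]] b_in_V \<sigma> by (simp add: near_def)
  finally show ?thesis using \<Gamma> \<sigma> comp_in by (simp add: near_def)
qed

text \<open>The modular function of the closure of \<open>\<Gamma>\<close>.\<close>

definition chi :: "('a \<Rightarrow> 'a) \<Rightarrow> real" where
  "chi \<sigma> = real (idx {b} {b, inv_into UNIV \<sigma> b}) / real (idx {b} {b, \<sigma> b})"

lemma chi_pos: "\<sigma> \<in> \<Gamma> \<Longrightarrow> 0 < chi \<sigma>"
  unfolding chi_def using idx_pos b_in_V inverse_in by simp

lemma chi_inverse: "\<sigma> \<in> \<Gamma> \<Longrightarrow> chi (inv_into UNIV \<sigma>) = 1 / chi \<sigma>"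
  using permutes[of \<sigma>] by (simp add: chi_def inv_inv_eq permutes_bij)

lemma map_in_V:
  assumes "p \<in> res T X" "X \<subseteq> \<Gamma>" "v \<in> T" "T \<subseteq> V"
  shows "p v \<in> V"
  using assms by (auto simp: subset_iff)

lemma avg_translate:
  assumes \<sigma>: "\<sigma> \<in> \<Gamma>" and v: "v \<in> V"
  shows "avg R (\<sigma> v) \<le> chi \<sigma> * avg (R + gdist E b (\<sigma> b)) v"
proof -
  define c where "c = inv_into UNIV \<sigma> b"
  have c: "\<sigma> c = b" "c \<in> V"
    using \<sigma> b_in_V inverse_in by (auto simp: c_def)
  define T where "T = {b, c, v}"
  let ?S = "R + gdist E b (\<sigma> b)"
  have T: "finite T" "T \<subseteq> V" "b \<in> T" "v \<in> T" "c \<in> T"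
    using c b_in_V v by (auto simp: T_def)
  have \<sigma>T: "finite (\<sigma> ` T)" "\<sigma> ` T \<subseteq> V" "b \<in> \<sigma> ` T" "\<sigma> v \<in> \<sigma> ` T" "\<sigma> b \<in> \<sigma> ` T"
    using T \<sigma> c(1) by auto
  \<comment> \<open>Both indices are factored through a pair: \<open>\<sigma>\<close> maps
    \<open>{b, c}\<close> to \<open>{\<sigma> b, b}\<close>, so the upper factors agree and the
    ratio of the lower ones is \<open>chi \<sigma>\<close>.\<close>
  have idx: "real (idx {b} T) = chi \<sigma> * real (idx {b} (\<sigma> ` T))"
  proof -
    have "idx {b} T = idx {b} {b, c} * idx {b, c} T"
      using T by (intro idx_mult) auto
    moreover have "idx {b} (\<sigma> ` T) = idx {b} {b, \<sigma> b} * idx {b, \<sigma> b} (\<sigma> ` T)"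
      using \<sigma>T by (intro idx_mult) auto
    moreover have "idx {b, \<sigma> b} (\<sigma> ` T) = idx {b, c} T"
      using idx_translate[OF \<sigma>, of "{b, c}" T] c(1) by (simp add: insert_commute)
    moreover have "0 < idx {b} {b, \<sigma> b}" using \<sigma>T by (intro idx_pos) auto
    ultimately show ?thesis by (simp add: chi_def c_def)
  qed
  have pos': "0 < idx {b} T" "0 < idx {b} (\<sigma> ` T)"
    using idx_pos T \<sigma>T by auto
  have "(\<Sum>p\<in>res (\<sigma> ` T) (near R). \<mu> (p (\<sigma> v))) =
      (\<Sum>p\<in>res (\<sigma> ` T) (near R). \<mu> (restrict (p \<circ> \<sigma>) T v))"
    using T by simp
  also have "\<dots> = (\<Sum>q\<in>res T ((\<lambda>h. h \<circ> \<sigma>) ` near R). \<mu> (q v))"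
    by (rule sum_res_translate)
  also have "\<dots> \<le> (\<Sum>q\<in>res T (near ?S). \<mu> (q v))"
  proof (rule sum_mono2)
    show "res T ((\<lambda>h. h \<circ> \<sigma>) ` near R) \<subseteq> res T (near ?S)"
      using near_translate \<sigma> by (intro image_mono) blast
    show "0 \<le> \<mu> (q v)" if "q \<in> res T (near ?S) - res T ((\<lambda>h. h \<circ> \<sigma>) ` near R)" for q
      using that T map_in_V[OF _ near_subset T(4,2)] pos by (meson DiffD1 less_imp_le)
  qed (use finite_res_near T in auto)
  finally have le: "(\<Sum>p\<in>res (\<sigma> ` T) (near R). \<mu> (p (\<sigma> v))) \<le> (\<Sum>q\<in>res T (near ?S). \<mu> (q v))" .
  have "avg R (\<sigma> v) = (\<Sum>p\<in>res (\<sigma> ` T) (near R). \<mu> (p (\<sigma> v))) / real (idx {b} (\<sigma> ` T))"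
    using \<sigma>T by (intro avg_eq) auto
  also have "\<dots> \<le> (\<Sum>q\<in>res T (near ?S). \<mu> (q v)) / real (idx {b} (\<sigma> ` T))"
    using le by (rule divide_right_mono) simp
  also have "\<dots> = chi \<sigma> * ((\<Sum>q\<in>res T (near ?S). \<mu> (q v)) / real (idx {b} T))"
    using idx pos' chi_pos[OF \<sigma>] by (simp add: field_simps)
  also have "\<dots> = chi \<sigma> * avg ?S v"
    using T avg_eq by simp
  finally show ?thesis .
qed

section \<open>Harnack bounds and growth at the base vertex\<close>

text \<open>With \<open>n\<close> the distance, \<open>u\<close> lies in the ball of radius
  \<open>2 ^ n\<close> about \<open>v\<close>. That radius is reached from 1/2, where the ball is
  just \<open>{v}\<close>, by \<open>n + 1\<close> doublings.\<close>

lemma harnack: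
  assumes "u \<in> V" "v \<in> V"
  shows "\<mu> u \<le> C ^ Suc (gdist E u v) * \<mu> v"
proof -
  let ?n = "gdist E u v"
  have "real ?n \<le> 2 ^ ?n"
    using of_nat_less_two_power[of ?n, where 'a = real] by (rule less_imp_le)
  then have "u \<in> gball V E v (2 ^ Suc ?n * (1 / 2))"
    using assms gdist_commute[of u v] by (simp add: gball_def)
  moreover have "0 \<le> \<mu> w" if "w \<in> gball V E v (2 ^ Suc ?n * (1 / 2))" for w
    using that pos gball_subset by (meson less_imp_le subsetD)
  ultimately have "\<mu> u \<le> sum \<mu> (gball V E v (2 ^ Suc ?n * (1 / 2)))"
    using finite_gball[OF assms(2)] by (intro member_le_sum) auto
  also have "\<dots> \<le> C ^ Suc ?n * sum \<mu> (gball V E v (1 / 2))"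
    using doubling[OF assms(2)] C_ge_1 by (intro doubling_iterate) auto
  finally show ?thesis using gball_less_one[OF assms(2), of "1 / 2"] by simp
qed

text \<open>The Harnack constant for the pair \<open>b\<close>, \<open>v\<close>; as distances are
  preserved, it serves for \<open>h b\<close>, \<open>h v\<close> uniformly in
  \<open>h\<close>.\<close>

definition K :: "'a \<Rightarrow> real" where
  "K v = C ^ Suc (gdist E b v)"

lemma K_pos: "0 < K v"
  using C_ge_1 by (simp add: K_def)

lemma harnack_res:
  assumes "p \<in> res T (near R)" "b \<in> T" "v \<in> T" "T \<subseteq> V"
  shows "\<mu> (p v) \<le> K v * \<mu> (p b)" "\<mu> (p b) \<le> K v * \<mu> (p v)"
proof -
  obtain h where h: "h \<in> \<Gamma>" "p = restrict h T" using assms(1) near_subset by blast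
  have v: "v \<in> V" using assms by blast
  have "gdist E (h b) (h v) = gdist E b v" "gdist E (h v) (h b) = gdist E b v"
    using aut_gdist[OF aut[OF h(1)]] b_in_V v gdist_commute by auto
  then show "\<mu> (p v) \<le> K v * \<mu> (p b)" "\<mu> (p b) \<le> K v * \<mu> (p v)"
    using harnack[of "h v" "h b"] harnack[of "h b" "h v"] b_in_V v h assms(2,3)
    by (auto simp: K_def)
qed

lemma avg_bounds:
  assumes v: "v \<in> V"
  shows "avg R v \<le> K v * avg R b" "avg R b \<le> K v * avg R v"
proof -
  let ?T = "{b, v}"
  have T: "finite ?T" "?T \<subseteq> V" "b \<in> ?T" "v \<in> ?T" using v b_in_V by auto
  have *: "(\<Sum>p\<in>res ?T (near R). \<mu> (p v)) \<le> K v * (\<Sum>p\<in>res ?T (near R). \<mu> (p b))"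
    "(\<Sum>p\<in>res ?T (near R). \<mu> (p b)) \<le> K v * (\<Sum>p\<in>res ?T (near R). \<mu> (p v))"
    unfolding sum_distrib_left by (intro sum_mono harnack_res[OF _ T(3,4,2)]; assumption)+
  show "avg R v \<le> K v * avg R b" "avg R b \<le> K v * avg R v"
    using *[THEN divide_right_mono, of "real (idx {b} ?T)"]
    unfolding avg_eq[OF T] avg_eq[OF T(1,2,3,3)] by simp_all
qed

text \<open>Only the restrictions gained between \<open>R\<close> and \<open>S\<close> contribute,
  and the Harnack bound applies to each. Slow growth at \<open>b\<close> thereby controls growth at
  every vertex.\<close>

lemma avg_increment:
  assumes v: "v \<in> V" and RS: "R \<le> S"
  shows "avg S v - avg R v \<le> K v * (avg S b - avg R b)"
proof -
  let ?T = "{b, v}"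
  have T: "finite ?T" "?T \<subseteq> V" "b \<in> ?T" "v \<in> ?T" using v b_in_V by auto
  let ?D = "res ?T (near S) - res ?T (near R)"
  have sub: "res ?T (near R) \<subseteq> res ?T (near S)" using near_mono[OF RS] by blast
  have diff: "avg S w - avg R w = (\<Sum>p\<in>?D. \<mu> (p w)) / real (idx {b} ?T)" if "w \<in> ?T" for w
    unfolding avg_eq[OF T(1,2,3) that] sum_diff[OF finite_res_near[OF T(1,2)] sub]
    by (rule diff_divide_distrib[symmetric])
  have "(\<Sum>p\<in>?D. \<mu> (p v)) \<le> K v * (\<Sum>p\<in>?D. \<mu> (p b))"
    unfolding sum_distrib_left by (intro sum_mono harnack_res[OF _ T(3,4,2)]) (erule DiffD1)
  from divide_right_mono[OF this, of "real (idx {b} ?T)"]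
  show ?thesis unfolding diff[OF T(3)] diff[OF T(4)] by simp
qed

lemma avg_base_mono:
  assumes "R \<le> S"
  shows "avg R b \<le> avg S b"
proof -
  have "(\<Sum>p\<in>res {b} (near R). \<mu> (p b)) \<le> (\<Sum>p\<in>res {b} (near S). \<mu> (p b))"
  proof (rule sum_mono2)
    show "res {b} (near R) \<subseteq> res {b} (near S)" using near_mono[OF assms] by blast
    show "0 \<le> \<mu> (p b)" if "p \<in> res {b} (near S) - res {b} (near R)" for p
      using that map_in_V[OF _ near_subset, of p "{b}" S b] b_in_V pos
      by (meson DiffD1 empty_subsetI insert_subset less_imp_le singletonI)
  qed (use finite_res_near b_in_V in auto)
  then show ?thesis
    unfolding avg_def using divide_right_mono[of _ _ "real (idx {b} {b, b})"] by simp
qed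

lemma avg_base_pos: "0 < avg R b"
proof -
  have "id \<in> near R" using id_in by (simp add: near_def)
  then have "0 < (\<Sum>p\<in>res {b} (near R). \<mu> (p b))"
    using finite_res_near[of "{b}"] map_in_V[OF _ near_subset, of _ "{b}" R b] b_in_V pos
    by (intro sum_pos) blast+
  moreover have "0 < idx {b} {b}" using idx_pos b_in_V by simp
  ultimately show ?thesis by (simp add: avg_def)
qed

text \<open>A restriction to \<open>{b}\<close> is determined by the image of \<open>b\<close>, so
  the sum runs over distinct points of the ball.\<close>

lemma avg_base_le: "avg R b \<le> sum \<mu> (gball V E b (real R))"
proof -
  let ?P = "res {b} (near R)"
  have inj: "inj_on (\<lambda>p. p b) ?P"
    by (rule inj_onI) (auto simp: fun_eq_iff)
  have in_V: "p b \<in> V" if "p \<in> ?P" for p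
    using map_in_V[OF that near_subset] b_in_V by simp
  have "1 \<le> real (idx {b} {b})" using idx_pos[of "{b}" "{b}"] b_in_V by simp
  moreover have "0 \<le> (\<Sum>p\<in>?P. \<mu> (p b))"
    using in_V pos less_imp_le by (intro sum_nonneg) blast
  ultimately have "avg R b \<le> (\<Sum>p\<in>?P. \<mu> (p b))"
    by (simp add: avg_def divide_le_eq mult_le_cancel_left1)
  also have "\<dots> = sum \<mu> ((\<lambda>p. p b) ` ?P)"
    using sum.reindex[OF inj, of \<mu>] by simp
  also have "\<dots> \<le> sum \<mu> (gball V E b (real R))"
  proof (rule sum_mono2)
    show "(\<lambda>p. p b) ` ?P \<subseteq> gball V E b (real R)"
      using b_in_V by (auto simp: gball_def near_def)
    show "0 \<le> \<mu> w" if "w \<in> gball V E b (real R) - (\<lambda>p. p b) ` ?P" for w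
      using that gball_subset pos by (meson DiffD1 less_imp_le subsetD)
  qed (use finite_gball b_in_V in auto)
  finally show ?thesis .
qed

text \<open>Doubling forces polynomial growth of \<open>avg R b\<close>, so it cannot grow by a fixed factor
  along an arithmetic progression of radii.\<close>

lemma slow_growth_radius:
  assumes "0 < \<epsilon>"
  shows "\<exists>R. avg (R + k) b \<le> (1 + \<epsilon>) * avg R b"
proof (rule ccontr)
  assume "\<not> ?thesis"
  then have *: "(1 + \<epsilon>) * avg R b \<le> avg (R + k) b" for R
    by (meson less_imp_le not_le)
  have "(1 + \<epsilon>) ^ j * avg 0 b \<le> avg (j * k) b" for j
  proof (induction j)
    case (Suc j)
    have "(1 + \<epsilon>) * ((1 + \<epsilon>) ^ j * avg 0 b) \<le> (1 + \<epsilon>) * avg (j * k) b"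
      using Suc assms by (intro mult_left_mono) auto
    also have "\<dots> \<le> avg (j * k + k) b" by (rule *)
    finally show ?case by (simp add: mult_ac add.commute)
  qed simp
  note low = this
  let ?B = "sum \<mu> (gball V E b (real k))"
  \<comment> \<open>Specialising to \<open>2 ^ i\<close> steps makes the radius accessible by
    \<open>i\<close> doublings from \<open>k\<close>.\<close>
  have "(1 + \<epsilon>) ^ (2 ^ i) \<le> ?B / avg 0 b * C ^ i" for i
  proof -
    have "(1 + \<epsilon>) ^ (2 ^ i) * avg 0 b \<le> avg (2 ^ i * k) b" by (rule low)
    also have "\<dots> \<le> sum \<mu> (gball V E b (2 ^ i * real k))"
      using avg_base_le[of "2 ^ i * k"] by simp
    also have "\<dots> \<le> C ^ i * ?B"
      using doubling[OF b_in_V] C_ge_1 by (intro doubling_iterate) auto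
    finally show ?thesis using avg_base_pos[of 0] by (simp add: field_simps)
  qed
  moreover have "0 < ?B"
    using b_in_V pos by (intro sum_gball_pos) (auto simp: graph_measure_def)
  ultimately have "1 + \<epsilon> \<le> 1"
    using assms avg_base_pos[of 0] C_ge_1
    by (intro le_one_if_double_exp_le[of _ "?B / avg 0 b" C]) auto
  then show False using assms by simp
qed

section \<open>Doubling of the averages and their limit\<close>

text \<open>Each \<open>h\<close> maps balls about \<open>v\<close> to balls about
  \<open>h v\<close>, where \<open>\<mu>\<close> is doubling; the inequality is then summed over
  \<open>h\<close>.\<close>

lemma avg_doubling:
  assumes v: "v \<in> V" and r: "0 \<le> r"
  shows "sum (avg R) (gball V E v (2 * r)) \<le> C * sum (avg R) (gball V E v r)"
proof -
  \<comment> \<open>A window containing the larger ball gives all the averages one index set and one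
    denominator.\<close>
  define T where "T = insert b (gball V E v (2 * r))"
  have T: "finite T" "T \<subseteq> V" "b \<in> T"
    using finite_gball v b_in_V gball_subset by (auto simp: T_def)
  let ?P = "res T (near R)"
  have sum_avg: "sum (avg R) (gball V E v s) =
      (\<Sum>p\<in>?P. \<Sum>w\<in>gball V E v s. \<mu> (p w)) / real (idx {b} T)" if "s \<le> 2 * r" for s
  proof -
    have "gball V E v s \<subseteq> T" using gball_mono[OF that] by (auto simp: T_def)
    then have "sum (avg R) (gball V E v s) =
        (\<Sum>w\<in>gball V E v s. (\<Sum>p\<in>?P. \<mu> (p w)) / real (idx {b} T))"
      using avg_eq[OF T] by (intro sum.cong) auto
    then show ?thesis by (simp add: sum_divide_distrib[symmetric] sum.swap[of _ ?P])
  qed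
  have "(\<Sum>w\<in>gball V E v (2 * r). \<mu> (p w)) \<le> C * (\<Sum>w\<in>gball V E v r. \<mu> (p w))"
    if "p \<in> ?P" for p
  proof -
    obtain h where h: "h \<in> \<Gamma>" "p = restrict h T" using \<open>p \<in> ?P\<close> near_subset by blast
    have "(\<Sum>w\<in>gball V E v s. \<mu> (p w)) = sum \<mu> (gball V E (h v) s)" if "s \<le> 2 * r" for s
    proof -
      have "gball V E v s \<subseteq> T" using gball_mono[OF that] by (auto simp: T_def)
      then have "(\<Sum>w\<in>gball V E v s. \<mu> (p w)) = (\<Sum>w\<in>gball V E v s. \<mu> (h w))"
        using h(2) by (intro sum.cong) auto
      also have "\<dots> = sum \<mu> (h ` gball V E v s)"
        using permutes_inj_on[OF permutes[OF h(1)]] by (simp add: sum.reindex)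
      finally show ?thesis using aut_gball[OF aut[OF h(1)] v] by simp
    qed
    then show ?thesis using doubling[of "h v" r] h(1) v r by simp
  qed
  then have "(\<Sum>p\<in>?P. \<Sum>w\<in>gball V E v (2 * r). \<mu> (p w))
      \<le> C * (\<Sum>p\<in>?P. \<Sum>w\<in>gball V E v r. \<mu> (p w))"
    unfolding sum_distrib_left[of C _ ?P] by (rule sum_mono)
  from divide_right_mono[OF this, of "real (idx {b} T)"]
  show ?thesis using sum_avg[of "2 * r"] sum_avg[of r] r by simp
qed

lemma equivariant_limit:
  obtains \<nu> where "graph_measure V \<nu>"
    "\<And>v r. v \<in> V \<Longrightarrow> 0 \<le> r \<Longrightarrow>
      sum \<nu> (gball V E v (2 * r)) \<le> C * sum \<nu> (gball V E v r)"
    "\<And>\<sigma> v. \<sigma> \<in> \<Gamma> \<Longrightarrow> v \<in> V \<Longrightarrow> \<nu> (\<sigma> v) = chi \<sigma> * \<nu> v"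
proof -
  \<comment> \<open>The tolerated enlargement \<open>n\<close> grows while the relative error
    shrinks, so one sequence of radii handles every displacement.\<close>
  have "\<forall>n. \<exists>R. avg (R + n) b \<le> (1 + inverse (real (Suc n))) * avg R b"
    by (intro allI slow_growth_radius) simp
  then obtain R where R: "\<And>n. avg (R n + n) b \<le> (1 + inverse (real (Suc n))) * avg (R n) b"
    by metis
  define N where "N n v = avg (R n) v / avg (R n) b" for n v
  have N_le: "N n v \<le> K v" and N_ge: "1 / K v \<le> N n v" if "v \<in> V" for n v
    using avg_bounds[OF that, of "R n"] avg_base_pos[of "R n"] K_pos[of v]
    by (auto simp: N_def field_simps)
  have N_nonneg: "0 \<le> N n v" if "v \<in> V" for n v
    using N_ge[OF that, of n] K_pos[of v] by (smt (verit) divide_nonneg_pos)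
  \<comment> \<open>Dividing by \<open>K v\<close> makes the bound uniform in \<open>v\<close>, as
    the extraction theorem demands.\<close>
  have "norm (N n v / K v) \<le> 1" if "v \<in> V" for n v
    using N_le[OF that, of n] N_nonneg[OF that, of n] K_pos[of v] by simp
  from function_convergent_subsequence[OF countable_V, of "\<lambda>n v. N n v / K v", OF this]
  obtain k :: "nat \<Rightarrow> nat" where k: "strict_mono k"
    and "\<And>v. v \<in> V \<Longrightarrow> \<exists>l. (\<lambda>n. N (k n) v / K v) \<longlonglongrightarrow> l" by blast
  then obtain l where l: "\<And>v. v \<in> V \<Longrightarrow> (\<lambda>n. N (k n) v / K v) \<longlonglongrightarrow> l v" by metis
  define \<nu> where "\<nu> v = K v * l v" for v
  have lim: "(\<lambda>n. N (k n) v) \<longlonglongrightarrow> \<nu> v" if "v \<in> V" for v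
    using tendsto_mult_left[OF l[OF that], of "K v"] K_pos[of v] by (simp add: \<nu>_def)
  have meas: "graph_measure V \<nu>"
    unfolding graph_measure_def
  proof
    fix v assume v: "v \<in> V"
    have "1 / K v \<le> \<nu> v" using N_ge[OF v] by (intro LIMSEQ_le_const[OF lim[OF v]]) blast
    then show "0 < \<nu> v" using K_pos[of v] by (smt (verit) divide_pos_pos)
  qed
  have doub: "sum \<nu> (gball V E v (2 * r)) \<le> C * sum \<nu> (gball V E v r)"
    if v: "v \<in> V" and r: "0 \<le> r" for v r
  proof (rule LIMSEQ_le)
    have *: "(\<lambda>n. sum (N (k n)) (gball V E v s)) \<longlonglongrightarrow> sum \<nu> (gball V E v s)" for s
      using lim gball_subset by (intro tendsto_sum) blast
    show "(\<lambda>n. sum (N (k n)) (gball V E v (2 * r))) \<longlonglongrightarrow> sum \<nu> (gball V E v (2 * r))"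
      by (rule *)
    show "(\<lambda>n. C * sum (N (k n)) (gball V E v r)) \<longlonglongrightarrow> C * sum \<nu> (gball V E v r)"
      by (intro tendsto_mult_left *)
    have "sum (N n) (gball V E v (2 * r)) \<le> C * sum (N n) (gball V E v r)" for n
      using divide_right_mono[OF avg_doubling[OF v r, of "R n"], of "avg (R n) b"]
        avg_base_pos[of "R n"] by (simp add: N_def sum_divide_distrib[symmetric])
    then show "\<exists>m. \<forall>n\<ge>m. sum (N (k n)) (gball V E v (2 * r)) \<le> C * sum (N (k n)) (gball V E v r)"
      by blast
  qed
  have le: "\<nu> (\<sigma> v) \<le> chi \<sigma> * \<nu> v" if \<sigma>: "\<sigma> \<in> \<Gamma>" and v: "v \<in> V" for \<sigma> v
  proof (rule LIMSEQ_le)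
    let ?d = "gdist E b (\<sigma> b)"
    show "(\<lambda>n. N (k n) (\<sigma> v)) \<longlonglongrightarrow> \<nu> (\<sigma> v)" using lim \<sigma> v by simp
    have "(\<lambda>n. inverse (real (Suc (k n)))) \<longlonglongrightarrow> 0"
      using LIMSEQ_subseq_LIMSEQ[OF LIMSEQ_inverse_real_of_nat k] by (simp add: o_def)
    from tendsto_mult_left[OF tendsto_add[OF lim[OF v] tendsto_mult_left[OF this]], of "chi \<sigma>" "K v"]
    show "(\<lambda>n. chi \<sigma> * (N (k n) v + K v * inverse (real (Suc (k n))))) \<longlonglongrightarrow> chi \<sigma> * \<nu> v"
      by simp
    \<comment> \<open>Enlarging \<open>R n\<close> by the displacement of \<open>\<sigma>\<close>
      costs at most the fraction \<open>1 / (n + 1)\<close> of \<open>avg (R n) b\<close> at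
      \<open>b\<close>, hence at most \<open>K v\<close> times as much at \<open>v\<close>.\<close>
    have N_translate: "N n (\<sigma> v) \<le> chi \<sigma> * (N n v + K v * inverse (real (Suc n)))"
      if n: "?d \<le> n" for n
    proof -
      let ?A = "avg (R n)" and ?e = "inverse (real (Suc n))"
      have "avg (R n + ?d) b \<le> avg (R n + n) b" using n by (intro avg_base_mono) simp
      then have "avg (R n + ?d) b - ?A b \<le> ?e * ?A b"
        using R[of n] by (simp add: algebra_simps)
      then have "K v * (avg (R n + ?d) b - ?A b) \<le> K v * (?e * ?A b)"
        using K_pos[of v] by (intro mult_left_mono) auto
      then have "avg (R n + ?d) v \<le> ?A v + K v * (?e * ?A b)"
        using avg_increment[OF v, of "R n" "R n + ?d"] by simp
      then have "chi \<sigma> * avg (R n + ?d) v \<le> chi \<sigma> * (?A v + K v * (?e * ?A b))"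
        using chi_pos[OF \<sigma>] by (intro mult_left_mono) auto
      then have "?A (\<sigma> v) \<le> chi \<sigma> * (?A v + K v * (?e * ?A b))"
        using avg_translate[OF \<sigma> v, of "R n"] by linarith
      from divide_right_mono[OF this, of "?A b"] show ?thesis
        using avg_base_pos[of "R n"] by (simp add: N_def add_divide_distrib distrib_left)
    qed
    show "\<exists>m. \<forall>n\<ge>m. N (k n) (\<sigma> v) \<le> chi \<sigma> * (N (k n) v + K v * inverse (real (Suc (k n))))"
      using N_translate seq_suble[OF k] order_trans by blast
  qed
  \<comment> \<open>The reverse inequality is \<open>le\<close> for the inverse of
    \<open>\<sigma>\<close> at \<open>\<sigma> v\<close>, since \<open>chi\<close> inverts.\<close>
  have "\<nu> (\<sigma> v) = chi \<sigma> * \<nu> v" if \<sigma>: "\<sigma> \<in> \<Gamma>" and v: "v \<in> V" for \<sigma> v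
  proof (rule antisym[OF le[OF \<sigma> v]])
    have "\<nu> v \<le> 1 / chi \<sigma> * \<nu> (\<sigma> v)"
      using le[OF inverse_in[OF \<sigma>], of "\<sigma> v"] \<sigma> v chi_inverse[OF \<sigma>] by simp
    then show "chi \<sigma> * \<nu> v \<le> \<nu> (\<sigma> v)"
      using chi_pos[OF \<sigma>] by (simp add: field_simps)
  qed
  with meas doub show thesis using that by blast
qed

section \<open>Triviality of the modular function\<close>

lemma gdist_funpow:
  assumes "\<sigma> \<in> \<Gamma>"
  shows "(\<sigma> ^^ j) b \<in> V \<and> gdist E b ((\<sigma> ^^ j) b) \<le> j * gdist E b (\<sigma> b)"
proof (induction j)
  case 0
  then show ?case using b_in_V by simp
next
  case (Suc j)
  let ?x = "(\<sigma> ^^ j) b"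
  have "gdist E b (\<sigma> ?x) \<le> gdist E b (\<sigma> b) + gdist E (\<sigma> b) (\<sigma> ?x)"
    using gdist_triangle b_in_V Suc assms by simp
  also have "gdist E (\<sigma> b) (\<sigma> ?x) = gdist E b ?x"
    using aut_gdist[OF aut[OF assms]] b_in_V Suc by simp
  finally show ?case using Suc assms by simp
qed

theorem invariant_doubling_measure:
  obtains \<nu> where "graph_measure V \<nu>"
    "\<And>v r. v \<in> V \<Longrightarrow> 0 \<le> r \<Longrightarrow>
      sum \<nu> (gball V E v (2 * r)) \<le> C * sum \<nu> (gball V E v r)"
    "\<And>\<sigma> v. \<sigma> \<in> \<Gamma> \<Longrightarrow> v \<in> V \<Longrightarrow> \<nu> (\<sigma> v) = \<nu> v"
proof -
  obtain \<nu> where meas: "graph_measure V \<nu>"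
    and doub: "\<And>v r. v \<in> V \<Longrightarrow> 0 \<le> r \<Longrightarrow>
      sum \<nu> (gball V E v (2 * r)) \<le> C * sum \<nu> (gball V E v r)"
    and equi: "\<And>\<sigma> v. \<sigma> \<in> \<Gamma> \<Longrightarrow> v \<in> V \<Longrightarrow> \<nu> (\<sigma> v) = chi \<sigma> * \<nu> v"
    using equivariant_limit by blast
  have \<nu>_pos: "0 < \<nu> v" if "v \<in> V" for v using meas that by (simp add: graph_measure_def)
  have chi_le: "chi \<sigma> \<le> 1" if \<sigma>: "\<sigma> \<in> \<Gamma>" for \<sigma>
  proof -
    have pow: "\<nu> ((\<sigma> ^^ j) b) = chi \<sigma> ^ j * \<nu> b" for j
    proof (induction j)
      case (Suc j)
      then show ?case using equi[OF \<sigma>, of "(\<sigma> ^^ j) b"] gdist_funpow[OF \<sigma>, of j] by simp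
    qed simp
    let ?d = "real (gdist E b (\<sigma> b))"
    let ?B = "sum \<nu> (gball V E b ?d)"
    have B: "0 < ?B" using meas b_in_V by (intro sum_gball_pos) auto
    \<comment> \<open>The \<open>2 ^ i\<close>-th iterate moves \<open>b\<close> by at most
      \<open>2 ^ i\<close> times the displacement of \<open>\<sigma>\<close>, so the mass of its
      image is bounded by \<open>i\<close> doublings of a fixed ball.\<close>
    have "chi \<sigma> ^ (2 ^ i) \<le> ?B / \<nu> b * C ^ i" for i
    proof -
      let ?x = "(\<sigma> ^^ (2 ^ i)) b"
      have "real (gdist E b ?x) \<le> real (2 ^ i * gdist E b (\<sigma> b))"
        using gdist_funpow[OF \<sigma>, of "2 ^ i"] by (simp only: of_nat_le_iff)
      then have "?x \<in> gball V E b (2 ^ i * ?d)"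
        using gdist_funpow[OF \<sigma>, of "2 ^ i"] by (simp add: gball_def)
      moreover have "0 \<le> \<nu> w" if "w \<in> gball V E b (2 ^ i * ?d)" for w
        using that \<nu>_pos gball_subset by (meson less_imp_le subsetD)
      ultimately have "\<nu> ?x \<le> sum \<nu> (gball V E b (2 ^ i * ?d))"
        using finite_gball[OF b_in_V] by (intro member_le_sum) auto
      also have "\<dots> \<le> C ^ i * ?B"
        using doub[OF b_in_V] C_ge_1 by (intro doubling_iterate) auto
      finally show ?thesis using pow[of "2 ^ i"] \<nu>_pos[OF b_in_V] by (simp add: field_simps)
    qed
    then show ?thesis
      using chi_pos[OF \<sigma>] B \<nu>_pos[OF b_in_V] C_ge_1
      by (intro le_one_if_double_exp_le[of _ "?B / \<nu> b" C]) auto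
  qed
  \<comment> \<open>The bound for the inverse of \<open>\<sigma>\<close> reads
    \<open>1 / chi \<sigma> \<le> 1\<close>.\<close>
  have "chi \<sigma> = 1" if \<sigma>: "\<sigma> \<in> \<Gamma>" for \<sigma>
    using chi_le[OF \<sigma>] chi_le[OF inverse_in[OF \<sigma>]] chi_inverse[OF \<sigma>] chi_pos[OF \<sigma>]
    by (simp add: divide_le_eq)
  then show thesis using that[OF meas doub] equi by simp
qed

end

theorem theorem4p3:
  fixes V :: "'a set" and E :: "'a set set" and \<Gamma> :: "('a \<Rightarrow> 'a) set"
  assumes "lf_graph V E"
    and "subgroup \<Gamma> (aut_group V E)"
    and "amenable \<Gamma>"
    and "doubling_measure V E \<mu>"
    and "bounded_measure V \<mu>"
  shows "\<exists>\<mu>\<^sub>\<Gamma>. doubling_measure V E \<mu>\<^sub>\<Gamma> \<and>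
           (\<forall>\<sigma>\<in>\<Gamma>. \<forall>v\<in>V. \<mu>\<^sub>\<Gamma> (\<sigma> v) = \<mu>\<^sub>\<Gamma> v) \<and>
           doubling_const V E \<mu>\<^sub>\<Gamma> \<le> doubling_const V E \<mu>"
proof (cases "V = {}")
  case True
  \<comment> \<open>Without vertices no base point exists, but invariance is vacuous and
    \<open>\<mu>\<close> itself serves.\<close>
  then show ?thesis using assms(4) by (intro exI[of _ \<mu>]) simp
next
  case False
  then obtain b where b: "b \<in> V" by blast
  interpret lf_graph V E by (rule assms(1))
  \<comment> \<open>Taking \<open>C\<close> to be the exact constant of \<open>\<mu>\<close> makes
    the inequality inherited by \<open>\<nu>\<close> yield the comparison of constants.\<close>
  obtain C where C: "1 \<le> C" "doubling_const V E \<mu> = ereal C"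
    "\<And>v r. v \<in> V \<Longrightarrow> 0 \<le> r \<Longrightarrow>
      sum \<mu> (gball V E v (2 * r)) \<le> C * sum \<mu> (gball V E v r)"
    using doubling_measureE[OF assms(4) False] by blast
  interpret doubling_action V E \<Gamma> \<mu> C b
  proof (intro doubling_action.intro doubling_action_axioms.intro)
    show "0 < \<mu> v" if "v \<in> V" for v
      using assms(4) that by (simp add: doubling_measure_def graph_measure_def)
  qed (fact assms(1,2) C(1,3) b)+
  obtain \<nu> where \<nu>: "graph_measure V \<nu>"
    "\<And>v r. v \<in> V \<Longrightarrow> 0 \<le> r \<Longrightarrow>
      sum \<nu> (gball V E v (2 * r)) \<le> C * sum \<nu> (gball V E v r)"
    "\<And>\<sigma> v. \<sigma> \<in> \<Gamma> \<Longrightarrow> v \<in> V \<Longrightarrow> \<nu> (\<sigma> v) = \<nu> v"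
    using invariant_doubling_measure by blast
  have "doubling_const V E \<nu> \<le> ereal C"
    using \<nu>(1,2) by (rule doubling_const_leI)
  moreover from this have "doubling_const V E \<nu> < \<infinity>"
    by (rule le_less_trans) simp
  ultimately show ?thesis
    using \<nu>(1,3) C(2) by (intro exI[of _ \<nu>]) (simp add: doubling_measure_def)
qed

end
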